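(* For every integer $s$, \[ \sum_{n=0}^\infty \frac{C_n F_{2n+s}}{4^{2n+2}}=\frac{F_{s-2}}{2}\left(1-\frac12\sqrt{\alpha\sqrt5}\right)+\frac{\alpha^{s-2}}{4}\sqrt{\frac{-\beta^3}{\sqrt5}}, \] \[ \sum_{n=0}^\infty \frac{C_n L_{2n+s}}{4^{2n+2}}=\frac{L_{s-2}}{2}\left(1-\frac12\sqrt{\alpha\sqrt5}\right)+\frac{\alpha^{s-2}}{4}\sqrt{-\beta^3\sqrt5}. \]
   Context: $C_n=\frac{1}{n+1}\binom{2n}{n}$ are the Catalan numbers. $\alpha=\frac{1+\sqrt5}{2}$, $\beta=\frac{1-\sqrt5}{2}$. The Fibonacci and Lucas numbers are defined for all integers $n$ by $F_n=\frac{\alpha^n-\beta^n}{\alpha-\beta}$ and $L_n=\alpha^n+\beta^n$ (so $F_0=0,F_1=1$, $L_0=2,L_1=1$, $F_{n+2}=F_{n+1}+F_n$, $L_{n+2}=L_{n+1}+L_n$). *)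

theory Defs
  imports Complex_Main
begin

definition phi :: real where
  "phi = (1 + sqrt 5) / 2"

definition psi :: real where
  "psi = (1 - sqrt 5) / 2"

definition catalan :: "nat \<Rightarrow> real" where
  "catalan n = 1 / (real n + 1) * real ((2 * n) choose n)"

(* The index ranges over all integers, so the Fibonacci function on nat from
   HOL-Number_Theory does not suffice. The values are taken in the reals; the
   lemmas below give the initial values and recurrences. *)

definition Fibonacci :: "int \<Rightarrow> real" where
  "Fibonacci n = (phi powi n - psi powi n) / (phi - psi)"

definition Lucas :: "int \<Rightarrow> real" where
  "Lucas n = phi powi n + psi powi n"

lemma phi_neq_psi: "phi \<noteq> psi"
  by (simp add: phi_def psi_def)

lemma phi_nonzero: "phi \<noteq> 0"
  using real_sqrt_ge_zero[of 5] by (simp add: phi_def add_nonneg_eq_0_iff)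

lemma psi_nonzero: "psi \<noteq> 0"
  by (simp add: psi_def)

lemma phi_powi_rec: "phi powi (n + 2) = phi powi (n + 1) + phi powi n"
proof -
  have "phi ^ 2 = phi + 1"
    by (simp add: phi_def power2_eq_square field_simps)
  thus ?thesis
    using phi_nonzero by (simp add: power_int_add algebra_simps)
qed

lemma psi_powi_rec: "psi powi (n + 2) = psi powi (n + 1) + psi powi n"
proof -
  have "psi ^ 2 = psi + 1"
    by (simp add: psi_def power2_eq_square field_simps)
  thus ?thesis
    using psi_nonzero by (simp add: power_int_add algebra_simps)
qed

lemma Fibonacci_0: "Fibonacci 0 = 0"
  by (simp add: Fibonacci_def)

lemma Fibonacci_1: "Fibonacci 1 = 1"
  using phi_neq_psi by (simp add: Fibonacci_def)

lemma Fibonacci_rec: "Fibonacci (n + 2) = Fibonacci (n + 1) + Fibonacci n"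
  by (simp add: Fibonacci_def phi_powi_rec psi_powi_rec diff_divide_distrib add_divide_distrib)

lemma Lucas_0: "Lucas 0 = 2"
  by (simp add: Lucas_def)

lemma Lucas_1: "Lucas 1 = 1"
  by (simp add: Lucas_def phi_def psi_def field_simps)

lemma Lucas_rec: "Lucas (n + 2) = Lucas (n + 1) + Lucas n"
  by (simp add: Lucas_def phi_powi_rec psi_powi_rec)

end

theory Submission
  imports Defs "HOL-Analysis.Generalised_Binomial_Theorem"
begin

text \<open>
  Write \<open>B x = (1 - sqrt (1 - 4 * x)) / 2\<close> for the generating function of \<open>catalan n * x ^ (n + 1)\<close>,
  which comes from the binomial series with exponent \<open>1/2\<close>. Evaluating it at \<open>x = phi^2 / 16\<close> and
  \<open>x = psi^2 / 16\<close> and applying Binet's formulas gives the sums in terms of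
  \<open>b = sqrt (1 - psi^2 / 4) = sqrt (phi * sqrt 5) / 2\<close> and \<open>a = sqrt (1 - phi^2 / 4)\<close>. Since
  \<open>a * b = sqrt 5 / 4\<close>, the difference satisfies \<open>(b - a)^2 = - (psi^3) * sqrt 5 / 4\<close>, which accounts
  for the second radical.
\<close>

lemma catalan_0: "catalan 0 = 1"
  by (simp add: catalan_def)

lemma catalan_fact: "catalan n = fact (2 * n) / ((real n + 1) * (fact n * fact n))"
  by (simp add: catalan_def binomial_fact mult_2)

lemma catalan_Suc: "(real n + 2) * catalan (Suc n) = 2 * (2 * real n + 1) * catalan n"
proof -
  have num: "fact (2 * Suc n) = 2 * (real n + 1) * (2 * real n + 1) * fact (2 * n)"
    by (simp add: algebra_simps)
  have den: "(real (Suc n) + 1) * (fact (Suc n) * fact (Suc n))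
      = (real n + 2) * (real n + 1) * ((real n + 1) * (fact n * fact n))"
    by (simp add: algebra_simps)
  have "real n + 1 \<noteq> 0" "real n + 2 \<noteq> 0" by linarith+
  then show ?thesis
    unfolding catalan_fact num den by (simp add: divide_simps) (simp add: algebra_simps)
qed

text \<open>Both sides have the same ratio of consecutive terms; \<open>catalan_Suc\<close> supplies
  it for the right-hand side.\<close>

lemma gbinomial_half_eq_catalan:
  "((1/2 :: real) gchoose Suc n) * (- 4) ^ Suc n = - 2 * catalan n"
proof (induction n)
  case 0
  then show ?case by (simp add: catalan_0)
next
  case (Suc n)
  \<comment> \<open>The two absorption identities share the term
    \<open>1/2 * ((1/2 - 1) gchoose Suc n)\<close>; equating their other sides gives the ratio of
    consecutive coefficients.\<close>
  have "((1/2 :: real) gchoose Suc (Suc n)) * (real n + 2) = (1/2 gchoose Suc n) * (- 1/2 - real n)"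
    using gbinomial_absorb_comp[of "1/2 :: real" "Suc n"] gbinomial_absorption[of "Suc n" "1/2 :: real"]
    by (simp add: algebra_simps)
  then have "((1/2 :: real) gchoose Suc (Suc n)) * (real n + 2) * (- 4) ^ Suc (Suc n)
      = (1/2 gchoose Suc n) * (- 1/2 - real n) * (- 4 * (- 4) ^ Suc n)"
    by simp
  also have "\<dots> = ((1/2 gchoose Suc n) * (- 4) ^ Suc n) * (2 * (2 * real n + 1))"
    by (simp add: algebra_simps)
  also have "\<dots> = (real n + 2) * (- 2 * catalan (Suc n))"
    unfolding Suc.IH using catalan_Suc[of n] by (simp add: algebra_simps)
  finally have "(real n + 2) * (((1/2 :: real) gchoose Suc (Suc n)) * (- 4) ^ Suc (Suc n))
      = (real n + 2) * (- 2 * catalan (Suc n))"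
    by (simp only: mult_ac)
  then show ?case
    by (subst (asm) mult_left_cancel) linarith+
qed

lemma catalan_generating_function:
  fixes x :: real
  assumes "\<bar>x\<bar> < 1 / 4"
  shows "(\<lambda>n. catalan n * x ^ Suc n) sums ((1 - sqrt (1 - 4 * x)) / 2)"
proof -
  have "(\<lambda>n. ((1/2) gchoose n) * (- 4 * x) ^ n) sums sqrt (1 + - 4 * x)"
    using assms by (intro sqrt_series) simp
  \<comment> \<open>Moving the constant term 1 to the right shifts the index to that of
    \<open>x ^ Suc n\<close>.\<close>
  then have "(\<lambda>n. ((1/2) gchoose Suc n) * (- 4 * x) ^ Suc n) sums (sqrt (1 - 4 * x) - 1)"
    by (subst sums_Suc_iff) simp
  moreover have "((1/2) gchoose Suc n) * (- 4 * x) ^ Suc n = - 2 * (catalan n * x ^ Suc n)" for n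
    using gbinomial_half_eq_catalan[of n] unfolding power_mult_distrib
    by (simp only: mult.assoc[symmetric])
  ultimately have "(\<lambda>n. - 2 * (catalan n * x ^ Suc n)) sums (sqrt (1 - 4 * x) - 1)"
    by (simp only:)
  from sums_mult[OF this, of "- 1/2"] show ?thesis
    by (simp del: power_Suc) (simp add: diff_divide_distrib)
qed

text \<open>This is the generating function at \<open>c^2 / 16\<close>, scaled by
  \<open>c powi (s - 2)\<close>: the exponent \<open>2 * n + s\<close> splits as
  \<open>(s - 2) + 2 * Suc n\<close>, and \<open>16 ^ Suc n = 4 ^ (2 * n + 2)\<close>. The bound on
  \<open>c\<close> puts the point inside the disc of radius 1/4.\<close>

lemma catalan_powi_sums:
  fixes c :: real
  assumes "c \<noteq> 0" and "c\<^sup>2 < 4"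
  shows "(\<lambda>n. catalan n * c powi (2 * int n + s) / 4 ^ (2 * n + 2)) sums
           (c powi (s - 2) / 2 * (1 - sqrt (1 - c\<^sup>2 / 4)))"
proof -
  have "(\<lambda>n. c powi (s - 2) * (catalan n * (c\<^sup>2 / 16) ^ Suc n)) sums
      (c powi (s - 2) * ((1 - sqrt (1 - 4 * (c\<^sup>2 / 16))) / 2))"
    using assms by (intro sums_mult catalan_generating_function) simp
  moreover have "c powi (s - 2) * (catalan n * (c\<^sup>2 / 16) ^ Suc n)
      = catalan n * c powi (2 * int n + s) / 4 ^ (2 * n + 2)" for n
  proof -
    have "c powi (2 * int n + s) = c powi (s - 2) * c powi (int (2 * Suc n))"
      using assms(1) by (subst power_int_add[symmetric]) (auto simp: algebra_simps)
    also have "\<dots> = c powi (s - 2) * (c\<^sup>2) ^ Suc n"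
      by (simp only: power_int_of_nat power_mult)
    finally show ?thesis
      using power_mult[of "4::real" 2 "Suc n"] by (simp add: power_divide)
  qed
  ultimately show ?thesis
    by (simp add: mult_ac del: power_Suc power_add power_add_numeral2)
qed

lemma sqrt_phi_psi_relations:
  shows "phi\<^sup>2 < 4" and "psi\<^sup>2 < 4"
    and "sqrt (1 - psi\<^sup>2 / 4) = 1 / 2 * sqrt (phi * sqrt 5)"
    and "sqrt (1 - psi\<^sup>2 / 4) - sqrt (1 - phi\<^sup>2 / 4) = 1 / 2 * sqrt (- (psi ^ 3) * sqrt 5)"
proof -
  define r :: real where "r = sqrt 5"
  have r: "r * r = 5" "2 < r" "r < 3"
    by (auto simp: r_def intro: real_less_rsqrt real_less_lsqrt)
  have phi: "phi = (1 + r) / 2" and psi: "psi = (1 - r) / 2"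
    by (simp_all add: phi_def psi_def r_def)
  have phi2: "1 - phi\<^sup>2 / 4 = (5 - r) / 8" and psi2: "1 - psi\<^sup>2 / 4 = (5 + r) / 8"
    using r(1) by (simp_all add: phi psi power2_eq_square field_simps)
  show "phi\<^sup>2 < 4" "psi\<^sup>2 < 4"
    using phi2 r(2,3) psi2 by argo+
  have "phi * sqrt 5 = 2\<^sup>2 * ((5 + r) / 8)"
    using r(1) unfolding r_def[symmetric] phi by (simp add: field_simps)
  then have "sqrt (phi * sqrt 5) = 2 * sqrt ((5 + r) / 8)"
    by (simp only: real_sqrt_mult) simp
  then show "sqrt (1 - psi\<^sup>2 / 4) = 1 / 2 * sqrt (phi * sqrt 5)"
    unfolding psi2 by simp
  define a b where "a = sqrt ((5 - r) / 8)" and "b = sqrt ((5 + r) / 8)"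
  have "a \<le> b" using r by (simp add: a_def b_def)
  \<comment> \<open>The product of the radicands is (25 - r^2) / 64 = 5 / 16, again a square in
    terms of \<open>r\<close>.\<close>
  have "a * b = sqrt ((r / 4)\<^sup>2)"
    unfolding a_def b_def real_sqrt_mult[symmetric] using r(1)
    by (simp add: power2_eq_square field_simps)
  then have ab: "a * b = r / 4" using r by simp
  have "a * a = (5 - r) / 8" "b * b = (5 + r) / 8"
    using r by (simp_all add: a_def b_def)
  \<comment> \<open>Expanding gives 5 - 2 * r, in which 5 is rewritten as
    \<open>r * r\<close>.\<close>
  then have "(2 * (b - a))\<^sup>2 = (r - 2) * r"
    using ab r(1) by (simp add: power2_eq_square algebra_simps)
  also have "r - 2 = - (psi ^ 3)"
  proof -
    have "psi * psi = psi + 1"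
      using r(1) by (simp add: psi field_simps)
    then have "psi ^ 3 = 2 * psi + 1"
      by (simp add: power3_eq_cube algebra_simps)
    then show ?thesis by (simp add: psi field_simps)
  qed
  \<comment> \<open>The order of \<open>a\<close> and \<open>b\<close> makes
    \<open>2 * (b - a)\<close> the nonnegative root.\<close>
  finally have "sqrt (- (psi ^ 3) * r) = 2 * (b - a)"
    using \<open>a \<le> b\<close> by (metis diff_ge_0_iff_ge mult_nonneg_nonneg real_sqrt_unique zero_le_numeral)
  then show "sqrt (1 - psi\<^sup>2 / 4) - sqrt (1 - phi\<^sup>2 / 4) = 1 / 2 * sqrt (- (psi ^ 3) * sqrt 5)"
    unfolding phi2 psi2 a_def[symmetric] b_def[symmetric] r_def[symmetric] by simp
qed

theorem theorem1:
  fixes s :: int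
  shows "(\<lambda>n. catalan n * Fibonacci (2 * int n + s) / 4 ^ (2 * n + 2)) sums
           (Fibonacci (s - 2) / 2 * (1 - 1 / 2 * sqrt (phi * sqrt 5))
             + phi powi (s - 2) / 4 * sqrt (- (psi ^ 3) / sqrt 5))
       \<and> (\<lambda>n. catalan n * Lucas (2 * int n + s) / 4 ^ (2 * n + 2)) sums
           (Lucas (s - 2) / 2 * (1 - 1 / 2 * sqrt (phi * sqrt 5))
             + phi powi (s - 2) / 4 * sqrt (- (psi ^ 3) * sqrt 5))"
proof -
  define P Q where "P = phi powi (s - 2)" and "Q = psi powi (s - 2)"
  define B D where "B = 1 / 2 * sqrt (phi * sqrt 5)" and "D = sqrt (- (psi ^ 3) * sqrt 5)"
  define f g where
    "f n = catalan n * phi powi (2 * int n + s) / 4 ^ (2 * n + 2)" and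
    "g n = catalan n * psi powi (2 * int n + s) / 4 ^ (2 * n + 2)" for n
  \<comment> \<open>Writing both radicals through \<open>B\<close> lets the two series share the
    factor \<open>1 - B\<close>. The correction \<open>D / 2\<close> stays with \<open>phi\<close>
    alone, hence the isolated power of \<open>phi\<close> in both sums.\<close>
  have a: "sqrt (1 - phi\<^sup>2 / 4) = B - D / 2" and b: "sqrt (1 - psi\<^sup>2 / 4) = B"
    using sqrt_phi_psi_relations by (simp_all add: B_def D_def)
  have f: "f sums (P / 2 * (1 - (B - D / 2)))"
    using catalan_powi_sums[OF phi_nonzero sqrt_phi_psi_relations(1), of s]
    unfolding a f_def P_def .
  have g: "g sums (Q / 2 * (1 - B))"
    using catalan_powi_sums[OF psi_nonzero sqrt_phi_psi_relations(2), of s]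
    unfolding b g_def Q_def .
  have diff: "phi - psi = sqrt 5"
    by (simp add: phi_def psi_def field_simps)
  \<comment> \<open>The radicals of the Fibonacci and Lucas formulas differ by the factor
    \<open>sqrt 5\<close>, which is the denominator in Binet's formula.\<close>
  have "D = sqrt ((- (psi ^ 3) / sqrt 5) * 5)"
    unfolding D_def by (simp add: field_simps)
  then have D: "sqrt (- (psi ^ 3) / sqrt 5) = D / sqrt 5"
    by (simp only: real_sqrt_mult) simp
  have "(\<lambda>n. (f n - g n) / sqrt 5) sums ((P / 2 * (1 - (B - D / 2)) - Q / 2 * (1 - B)) / sqrt 5)"
    by (intro sums_divide sums_diff f g)
  moreover have "(f n - g n) / sqrt 5 = catalan n * Fibonacci (2 * int n + s) / 4 ^ (2 * n + 2)" for n
    by (simp add: f_def g_def Fibonacci_def diff field_simps)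
  moreover have "(P / 2 * (1 - (B - D / 2)) - Q / 2 * (1 - B)) / sqrt 5
      = Fibonacci (s - 2) / 2 * (1 - B) + P / 4 * (D / sqrt 5)"
    by (simp add: Fibonacci_def diff P_def Q_def field_simps)
  moreover have "(\<lambda>n. f n + g n) sums (P / 2 * (1 - (B - D / 2)) + Q / 2 * (1 - B))"
    by (intro sums_add f g)
  moreover have "f n + g n = catalan n * Lucas (2 * int n + s) / 4 ^ (2 * n + 2)" for n
    by (simp add: f_def g_def Lucas_def field_simps)
  moreover have "P / 2 * (1 - (B - D / 2)) + Q / 2 * (1 - B)
      = Lucas (s - 2) / 2 * (1 - B) + P / 4 * D"
    by (simp add: Lucas_def P_def Q_def field_simps)
  ultimately show ?thesis
    unfolding D by (simp add: B_def D_def P_def)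
qed

end
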